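(* Let $D$ be an integral domain with quotient field $K$ and let $E$ be a nonempty subset of $K$. If $\mathrm{Int}^{\mathrm R}(E,D)$ is a strong Mori domain, then $D$ is a strong Mori domain.
   Context: $\mathrm{Int}^{\mathrm R}(E,D):=\{f\in K(X);\ f(E)\subseteq D\}$, where $f(E)\subseteq D$ means that for every $e\in E$ the rational function $f$ is defined at $e$ and $f(e)\in D$. For an integral domain $R$ with quotient field $F$ and a nonzero fractional ideal $I$ of $R$, $I^{-1}:=\{x\in F;\ xI\subseteq R\}$ and $I_w:=\{x\in F;\ xJ\subseteq I$ for some nonzero finitely generated ideal $J$ of $R$ with $J^{-1}=R\}$. A nonzero ideal $I$ of $R$ is a $w$-ideal if $I_w=I$. $R$ is a strong Mori domain if it satisfies the ascending chain condition on $w$-ideals of $R$. *)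

theory Defs
  imports
    "HOL-Computational_Algebra.Fraction_Field"
    "HOL-Computational_Algebra.Polynomial"
    "HOL-Algebra.Algebraic_Closure_Type"
    "HOL-Algebra.Subrings"
begin

section \<open>Strong Mori domains\<close>

text \<open>
  An integral domain is represented as a subring \<open>R\<close> of a field, the field being a type.
  The field may be strictly larger than the quotient field of \<open>R\<close>, which is therefore
  recovered from \<open>R\<close> itself by \<open>quot_field\<close>. The ring structure carried by \<open>R\<close> is
  the \<open>ring_of_type_algebra\<close> of the ambient field, restricted to \<open>R\<close>.
\<close>

abbreviation ring_on :: "'f::field set \<Rightarrow> 'f ring"
  where "ring_on R \<equiv> ring_of_type_algebra\<lparr>carrier := R\<rparr>"

definition quot_field :: "'f::field set \<Rightarrow> 'f set"
  where "quot_field R = {a / b |a b. a \<in> R \<and> b \<in> R \<and> b \<noteq> 0}"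

definition frac_inverse :: "'f::field set \<Rightarrow> 'f set \<Rightarrow> 'f set"
  where "frac_inverse R I = {x \<in> quot_field R. \<forall>a\<in>I. x * a \<in> R}"

definition fg_ideal :: "'f::field set \<Rightarrow> 'f set \<Rightarrow> bool"
  where "fg_ideal R J \<longleftrightarrow> (\<exists>A\<subseteq>R. finite A \<and> J = Idl\<^bsub>ring_on R\<^esub> A)"

definition w_closure :: "'f::field set \<Rightarrow> 'f set \<Rightarrow> 'f set"
  where "w_closure R I =
    {x \<in> quot_field R. \<exists>J. fg_ideal R J \<and> J \<noteq> {0} \<and> frac_inverse R J = R \<and> (\<forall>a\<in>J. x * a \<in> I)}"

definition w_ideal :: "'f::field set \<Rightarrow> 'f set \<Rightarrow> bool"
  where "w_ideal R I \<longleftrightarrow> ideal I (ring_on R) \<and> I \<noteq> {0} \<and> w_closure R I = I"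

definition strong_mori_domain :: "'f::field set \<Rightarrow> bool"
  where "strong_mori_domain R \<longleftrightarrow>
    subdomain R ring_of_type_algebra \<and>
    (\<forall>I :: nat \<Rightarrow> 'f set. (\<forall>n. w_ideal R (I n)) \<and> (\<forall>n. I n \<subseteq> I (Suc n)) \<longrightarrow>
      (\<exists>N. \<forall>n\<ge>N. I n = I N))"


section \<open>Integer-valued rational functions\<close>

text \<open>
  The field \<open>K(X)\<close> is the type \<open>'k poly fract\<close>. A rational function is defined at \<open>e\<close> if
  some representation of it as a fraction has a denominator not vanishing at \<open>e\<close>;
  its value \<open>rat_val f e\<close> at \<open>e\<close> is meaningful only in this case.
\<close>

definition rat_defined_at :: "'k::field poly fract \<Rightarrow> 'k \<Rightarrow> bool"
  where "rat_defined_at f e \<longleftrightarrow> (\<exists>p q. f = Fract p q \<and> poly q e \<noteq> 0)"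

definition rat_val :: "'k::field poly fract \<Rightarrow> 'k \<Rightarrow> 'k"
  where "rat_val f e = (THE v. \<exists>p q. f = Fract p q \<and> poly q e \<noteq> 0 \<and> v = poly p e / poly q e)"

lemma rat_val_Fract:
  assumes "poly q e \<noteq> 0"
  shows "rat_val (Fract p q) e = poly p e / poly q e"
  unfolding rat_val_def
proof (rule the_equality)
  fix v assume "\<exists>p' q'. Fract p q = Fract p' q' \<and> poly q' e \<noteq> 0 \<and> v = poly p' e / poly q' e"
  then obtain p' q' where *: "Fract p q = Fract p' q'" "poly q' e \<noteq> 0" "v = poly p' e / poly q' e"
    by blast
  have "q \<noteq> 0" "q' \<noteq> 0" using assms * by auto
  then have "p * q' = p' * q" using * by (simp add: eq_fract)
  then have "poly p e * poly q' e = poly p' e * poly q e" by (metis poly_mult)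
  then show "v = poly p e / poly q e" using assms * by (simp add: frac_eq_eq)
qed (use assms in blast)

definition Int_R :: "'k::field set \<Rightarrow> 'k set \<Rightarrow> 'k poly fract set"
  where "Int_R E D = {f. \<forall>e\<in>E. rat_defined_at f e \<and> rat_val f e \<in> D}"

end

theory Submission
  imports Defs
begin

text \<open>
  Write \<open>R\<close> for \<open>Int_R E D\<close>. An ascending chain of w-ideals \<open>I n\<close> of \<open>D\<close> is lifted to the chain of
  w-ideals \<open>w_closure R (Int_R E (I n))\<close> of \<open>R\<close>, which becomes stationary. It remains to recover
  \<open>I n\<close> from its lift, and in fact \<open>I n\<close> is the set of constants in it
  (\<open>const_fract_mem_w_closure_Int_R\<close>).

  To see this, let \<open>x\<close> be a constant with \<open>x B \<subseteq> Int_R E I\<close>, where \<open>B\<close> is finite, not contained in \<open>{0}\<close>,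
  and has inverse \<open>R\<close>. The values at a single point of \<open>E\<close> of the members of \<open>B\<close> need not generate an
  ideal with inverse \<open>D\<close>. But the set \<open>A\<close> of all values \<open>b(e)\<close>, with \<open>b \<in> B\<close> and \<open>e \<in> E\<close>, does:
  if \<open>y A \<subseteq> D\<close> for a constant \<open>y\<close>, then \<open>y B \<subseteq> R\<close>, hence \<open>y \<in> R\<close> and \<open>y \<in> D\<close>. Moreover \<open>x A \<subseteq> I\<close>.
  As \<open>A\<close> may be infinite, this alone does not give \<open>x \<in> I\<close>; one needs a finite subset of \<open>A\<close> with the
  same inverse.

  Such a subset exists because \<open>D\<close> is a Mori domain (\<open>frac_inverse_finite_subset\<close>). This is a first,
  easier, descent from \<open>R\<close> to \<open>D\<close>: for \<open>F \<subseteq> D\<close> the elements \<open>f\<close> of \<open>R\<close> with \<open>F\<inverse> f \<subseteq> R\<close> form a w-ideal of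
  \<open>R\<close> (unless this ideal is zero) whose constants are the divisorial closure of \<open>F\<close>.
\<close>

section \<open>Subdomains of a field and their ideals\<close>

lemma ring_of_type_algebra_simps [simp]:
  "x \<otimes>\<^bsub>ring_of_type_algebra\<^esub> y = x * y"
  "x \<oplus>\<^bsub>ring_of_type_algebra\<^esub> y = x + y"
  "\<zero>\<^bsub>ring_of_type_algebra\<^esub> = 0"
  "\<one>\<^bsub>ring_of_type_algebra\<^esub> = 1"
  by (simp_all add: ring_of_type_algebra_def)

lemma ring_ring_on:
  assumes "subdomain R (ring_of_type_algebra :: 'f::field ring)"
  shows "ring (ring_on R)"
proof -
  interpret T: ring "ring_of_type_algebra :: 'f ring" by (rule ring_from_type_algebra)
  show ?thesis
    using assms by (intro T.subring_is_ring) (simp add: subdomain.axioms(1) subcring.axioms(1))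
qed

lemma subdomain_closed:
  assumes "subdomain R (ring_of_type_algebra :: 'f::field ring)"
  shows "0 \<in> R" "1 \<in> R"
    and "x \<in> R \<Longrightarrow> y \<in> R \<Longrightarrow> x + y \<in> R"
    and "x \<in> R \<Longrightarrow> y \<in> R \<Longrightarrow> x * y \<in> R"
    and "x \<in> R \<Longrightarrow> - x \<in> R"
proof -
  interpret R: ring "ring_on R" using assms by (rule ring_ring_on)
  show "0 \<in> R" "1 \<in> R" "x \<in> R \<Longrightarrow> y \<in> R \<Longrightarrow> x + y \<in> R" "x \<in> R \<Longrightarrow> y \<in> R \<Longrightarrow> x * y \<in> R"
    using R.zero_closed R.one_closed R.add.m_closed[of x y] R.m_closed[of x y] by simp_all
  show "- x \<in> R" if "x \<in> R"
  proof -
    have "\<exists>y\<in>R. y + x = 0" using R.add.l_inv_ex[of x] that by auto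
    then show ?thesis by (metis eq_neg_iff_add_eq_0)
  qed
qed

lemma ideal_ring_on_iff:
  assumes R: "subdomain R (ring_of_type_algebra :: 'f::field ring)"
  shows "ideal I (ring_on R) \<longleftrightarrow>
    I \<subseteq> R \<and> 0 \<in> I \<and> (\<forall>x\<in>I. \<forall>y\<in>I. x + y \<in> I) \<and> (\<forall>x\<in>I. \<forall>r\<in>R. r * x \<in> I)"
proof
  assume "ideal I (ring_on R)"
  then interpret ideal I "ring_on R" .
  show "I \<subseteq> R \<and> 0 \<in> I \<and> (\<forall>x\<in>I. \<forall>y\<in>I. x + y \<in> I) \<and> (\<forall>x\<in>I. \<forall>r\<in>R. r * x \<in> I)"
    using a_subset additive_subgroup.zero_closed[OF is_additive_subgroup]
      additive_subgroup.a_closed[OF is_additive_subgroup] I_l_closed by auto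
next
  assume I: "I \<subseteq> R \<and> 0 \<in> I \<and> (\<forall>x\<in>I. \<forall>y\<in>I. x + y \<in> I) \<and> (\<forall>x\<in>I. \<forall>r\<in>R. r * x \<in> I)"
  interpret R: ring "ring_on R" using R by (rule ring_ring_on)
  show "ideal I (ring_on R)"
  proof (rule idealI[OF R.ring_axioms])
    show "subgroup I (add_monoid (ring_on R))"
    proof (rule R.add.subgroupI)
      fix x assume "x \<in> I"
      then have "(- 1) * x \<in> I" using I subdomain_closed[OF R] by blast
      moreover have "\<ominus>\<^bsub>ring_on R\<^esub> x = - x"
        using \<open>x \<in> I\<close> I subdomain_closed[OF R] by (intro R.minus_equality) auto
      ultimately show "\<ominus>\<^bsub>ring_on R\<^esub> x \<in> I" by simp
    qed (use I in auto)
  qed (use I in \<open>auto simp: mult.commute\<close>)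
qed

lemma subset_quot_field:
  assumes "subdomain R (ring_of_type_algebra :: 'f::field ring)"
  shows "R \<subseteq> quot_field R"
proof
  fix x assume "x \<in> R"
  then have "x = x / 1 \<and> x \<in> R \<and> 1 \<in> R \<and> (1::'f) \<noteq> 0" using subdomain_closed[OF assms] by simp
  then show "x \<in> quot_field R" unfolding quot_field_def by blast
qed

lemma quot_field_mult:
  assumes "subdomain R (ring_of_type_algebra :: 'f::field ring)"
    and "x \<in> quot_field R" "y \<in> quot_field R"
  shows "x * y \<in> quot_field R"
proof -
  obtain a b c d where "x = a / b" "y = c / d" "a \<in> R" "b \<in> R" "b \<noteq> 0" "c \<in> R" "d \<in> R" "d \<noteq> 0"
    using assms(2,3) unfolding quot_field_def by auto
  then have "x * y = (a * c) / (b * d) \<and> a * c \<in> R \<and> b * d \<in> R \<and> b * d \<noteq> 0"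
    using subdomain_closed[OF assms(1)] by simp
  then show ?thesis unfolding quot_field_def by blast
qed

lemma strong_mori_domain_stabilizes:
  assumes "strong_mori_domain R" "\<And>n. w_ideal R (I n)" "\<And>n. I n \<subseteq> I (Suc n)"
  shows "\<exists>N. \<forall>n\<ge>N. I n = I N"
proof -
  have "(\<forall>n. w_ideal R (I n)) \<and> (\<forall>n. I n \<subseteq> I (Suc n)) \<longrightarrow> (\<exists>N. \<forall>n\<ge>N. I n = I N)"
    using assms(1) unfolding strong_mori_domain_def by (elim conjE allE)
  then show ?thesis using assms(2,3) by simp
qed

section \<open>The w-closure in terms of finite generating sets\<close>

text \<open>
  Multiplying an ideal \<open>Idl A\<close> into an ideal \<open>I\<close> can be tested on the generators. Here \<open>I\<close> may be
  \<open>R\<close> itself, and \<open>x\<close> is any element of the ambient field.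
\<close>

lemma mult_Idl_iff:
  assumes R: "subdomain R (ring_of_type_algebra :: 'f::field ring)"
    and I: "ideal I (ring_on R)" and "A \<subseteq> R"
  shows "(\<forall>a\<in>Idl\<^bsub>ring_on R\<^esub> A. x * a \<in> I) \<longleftrightarrow> (\<forall>a\<in>A. x * a \<in> I)"
proof
  assume "\<forall>a\<in>Idl\<^bsub>ring_on R\<^esub> A. x * a \<in> I"
  then show "\<forall>a\<in>A. x * a \<in> I" unfolding genideal_def by blast
next
  assume A: "\<forall>a\<in>A. x * a \<in> I"
  have "ideal {r \<in> R. x * r \<in> I} (ring_on R)"
    using I subdomain_closed[OF R] unfolding ideal_ring_on_iff[OF R]
    by (auto simp: distrib_left mult.left_commute)
  moreover have "A \<subseteq> {r \<in> R. x * r \<in> I}" using A \<open>A \<subseteq> R\<close> by auto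
  ultimately show "\<forall>a\<in>Idl\<^bsub>ring_on R\<^esub> A. x * a \<in> I" unfolding genideal_def by blast
qed

lemma ideal_carrier:
  assumes R: "subdomain R (ring_of_type_algebra :: 'f::field ring)"
  shows "ideal R (ring_on R)"
  using subdomain_closed[OF R] by (simp add: ideal_ring_on_iff[OF R])

lemma frac_inverse_Idl:
  assumes R: "subdomain R (ring_of_type_algebra :: 'f::field ring)" and "A \<subseteq> R"
  shows "frac_inverse R (Idl\<^bsub>ring_on R\<^esub> A) = frac_inverse R A"
  unfolding frac_inverse_def using mult_Idl_iff[OF R ideal_carrier[OF R] \<open>A \<subseteq> R\<close>] by simp

lemma Idl_eq_zero_iff:
  assumes R: "subdomain R (ring_of_type_algebra :: 'f::field ring)" and "A \<subseteq> R"
  shows "Idl\<^bsub>ring_on R\<^esub> A = {0} \<longleftrightarrow> A \<subseteq> {0}"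
proof
  assume "Idl\<^bsub>ring_on R\<^esub> A = {0}"
  then show "A \<subseteq> {0}" unfolding genideal_def by blast
next
  assume "A \<subseteq> {0}"
  moreover have "ideal {0} (ring_on R)"
    using subdomain_closed[OF R] by (simp add: ideal_ring_on_iff[OF R])
  ultimately have "Idl\<^bsub>ring_on R\<^esub> A \<subseteq> {0}" unfolding genideal_def by blast
  moreover have "0 \<in> Idl\<^bsub>ring_on R\<^esub> A"
    unfolding genideal_def by (auto simp: ideal_ring_on_iff[OF R])
  ultimately show "Idl\<^bsub>ring_on R\<^esub> A = {0}" by blast
qed

text \<open>
  A finite set generating a Glaz--Vasconcelos ideal: a nonzero ideal with inverse \<open>R\<close>.
  That the ideal is nonzero has to be required only when \<open>R\<close> is a field.
\<close>

definition gv_set :: "'f::field set \<Rightarrow> 'f set \<Rightarrow> bool"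
  where "gv_set R A \<longleftrightarrow> A \<subseteq> R \<and> finite A \<and> \<not> A \<subseteq> {0} \<and> frac_inverse R A = R"

lemma w_closure_iff:
  assumes R: "subdomain R (ring_of_type_algebra :: 'f::field ring)"
    and I: "ideal I (ring_on R)"
  shows "x \<in> w_closure R I \<longleftrightarrow> x \<in> quot_field R \<and> (\<exists>A. gv_set R A \<and> (\<forall>a\<in>A. x * a \<in> I))"
proof -
  have Idl: "Idl\<^bsub>ring_on R\<^esub> A \<noteq> {0} \<and> frac_inverse R (Idl\<^bsub>ring_on R\<^esub> A) = R \<and>
      (\<forall>a\<in>Idl\<^bsub>ring_on R\<^esub> A. x * a \<in> I) \<longleftrightarrow>
    \<not> A \<subseteq> {0} \<and> frac_inverse R A = R \<and> (\<forall>a\<in>A. x * a \<in> I)" if "A \<subseteq> R" for A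
    using frac_inverse_Idl[OF R that] mult_Idl_iff[OF R I that] Idl_eq_zero_iff[OF R that] by simp
  have "(\<exists>J. fg_ideal R J \<and> J \<noteq> {0} \<and> frac_inverse R J = R \<and> (\<forall>a\<in>J. x * a \<in> I)) \<longleftrightarrow>
    (\<exists>A. A \<subseteq> R \<and> finite A \<and> (Idl\<^bsub>ring_on R\<^esub> A \<noteq> {0} \<and>
      frac_inverse R (Idl\<^bsub>ring_on R\<^esub> A) = R \<and> (\<forall>a\<in>Idl\<^bsub>ring_on R\<^esub> A. x * a \<in> I)))"
    unfolding fg_ideal_def by metis
  also have "\<dots> \<longleftrightarrow> (\<exists>A. gv_set R A \<and> (\<forall>a\<in>A. x * a \<in> I))"
    unfolding gv_set_def using Idl by (intro ex_cong1) (simp add: conj_assoc cong: conj_cong)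
  finally show ?thesis unfolding w_closure_def by simp
qed

lemma gv_set_one:
  assumes R: "subdomain R (ring_of_type_algebra :: 'f::field ring)"
  shows "gv_set R {1}"
  using subdomain_closed[OF R] subset_quot_field[OF R]
  by (auto simp: gv_set_def frac_inverse_def)

lemma gv_set_mult:
  assumes R: "subdomain R (ring_of_type_algebra :: 'f::field ring)"
    and A: "gv_set R A" and B: "gv_set R B"
  shows "gv_set R {a * b |a b. a \<in> A \<and> b \<in> B}"
  unfolding gv_set_def
proof (intro conjI)
  let ?C = "{a * b |a b. a \<in> A \<and> b \<in> B}"
  show C: "?C \<subseteq> R" using A B subdomain_closed(4)[OF R] unfolding gv_set_def by blast
  have "?C = (\<lambda>(a, b). a * b) ` (A \<times> B)" by auto
  then show "finite ?C" using A B by (simp add: gv_set_def)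
  obtain a b where "a \<in> A" "a \<noteq> 0" "b \<in> B" "b \<noteq> 0" using A B by (auto simp: gv_set_def)
  then have "a * b \<in> ?C" "a * b \<noteq> 0" by auto
  then show "\<not> ?C \<subseteq> {0}" by blast
  show "frac_inverse R ?C = R"
  proof
    show "R \<subseteq> frac_inverse R ?C"
      using C subdomain_closed(4)[OF R] subset_quot_field[OF R] unfolding frac_inverse_def by blast
    show "frac_inverse R ?C \<subseteq> R"
    proof
      fix x assume x: "x \<in> frac_inverse R ?C"
      have "x * a \<in> R" if "a \<in> A" for a
      proof -
        have "x * a \<in> quot_field R"
          using x A that subset_quot_field[OF R]
          by (auto simp: frac_inverse_def gv_set_def intro!: quot_field_mult[OF R])
        moreover have "x * a * b \<in> R" if "b \<in> B" for b
          using x \<open>a \<in> A\<close> that by (auto simp: frac_inverse_def mult.assoc)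
        ultimately have "x * a \<in> frac_inverse R B" by (simp add: frac_inverse_def)
        then show ?thesis using B by (simp add: gv_set_def)
      qed
      then have "x \<in> frac_inverse R A" using x by (simp add: frac_inverse_def)
      then show "x \<in> R" using A by (simp add: gv_set_def)
    qed
  qed
qed

lemma gv_set_mem:
  assumes "gv_set R A" "x \<in> quot_field R" "\<And>a. a \<in> A \<Longrightarrow> x * a \<in> R"
  shows "x \<in> R"
  using assms by (auto simp: gv_set_def frac_inverse_def)

lemma subset_w_closure:
  assumes R: "subdomain R (ring_of_type_algebra :: 'f::field ring)"
    and I: "ideal I (ring_on R)"
  shows "I \<subseteq> w_closure R I"
proof
  fix x assume "x \<in> I"
  moreover from this have "x \<in> quot_field R"
    using I subset_quot_field[OF R] by (auto simp: ideal_ring_on_iff[OF R])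
  ultimately show "x \<in> w_closure R I"
    unfolding w_closure_iff[OF R I] by (intro conjI exI[of _ "{1}"]) (simp_all add: gv_set_one[OF R])
qed

lemma w_closure_subset:
  assumes R: "subdomain R (ring_of_type_algebra :: 'f::field ring)"
    and I: "ideal I (ring_on R)"
  shows "w_closure R I \<subseteq> R"
proof
  fix x assume "x \<in> w_closure R I"
  then obtain A where A: "gv_set R A" and x: "x \<in> quot_field R" "\<forall>a\<in>A. x * a \<in> I"
    by (auto simp: w_closure_iff[OF R I])
  have "I \<subseteq> R" using I by (simp add: ideal_ring_on_iff[OF R])
  then show "x \<in> R" using x(2) by (intro gv_set_mem[OF A x(1)]) auto
qed

text \<open>Finitely many elements of the w-closure of \<open>I\<close> are multiplied into \<open>I\<close> by one common ideal.\<close>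

lemma w_closure_common_gv_set:
  assumes R: "subdomain R (ring_of_type_algebra :: 'f::field ring)"
    and I: "ideal I (ring_on R)" and "finite S" "S \<subseteq> w_closure R I"
  shows "\<exists>A. gv_set R A \<and> (\<forall>x\<in>S. \<forall>a\<in>A. x * a \<in> I)"
  using \<open>finite S\<close> \<open>S \<subseteq> w_closure R I\<close>
proof (induction rule: finite_induct)
  case empty
  then show ?case using gv_set_one[OF R] by blast
next
  case (insert y S)
  then obtain A B where A: "gv_set R A" "\<forall>x\<in>S. \<forall>a\<in>A. x * a \<in> I"
    and B: "gv_set R B" "\<forall>b\<in>B. y * b \<in> I"
    by (auto simp: w_closure_iff[OF R I])
  have "x * (a * b) \<in> I" if "x \<in> insert y S" "a \<in> A" "b \<in> B" for x a b
  proof -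
    have "a \<in> R" "b \<in> R" using A(1) B(1) that by (auto simp: gv_set_def)
    have RI: "r * z \<in> I" if "r \<in> R" "z \<in> I" for r z using I that by (auto simp: ideal_ring_on_iff[OF R])
    show ?thesis
    proof (cases "x = y")
      case True
      then show ?thesis using RI[OF \<open>a \<in> R\<close>, of "y * b"] B that by (simp add: mult.left_commute)
    next
      case False
      then have "b * (x * a) \<in> I" using A that by (intro RI[OF \<open>b \<in> R\<close>]) auto
      then show ?thesis by (simp add: mult_ac)
    qed
  qed
  then have "\<forall>x\<in>insert y S. \<forall>c\<in>{a * b |a b. a \<in> A \<and> b \<in> B}. x * c \<in> I" by blast
  with gv_set_mult[OF R A(1) B(1)] show ?case by (intro exI conjI)
qed

lemma ideal_w_closure:
  assumes R: "subdomain R (ring_of_type_algebra :: 'f::field ring)"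
    and I: "ideal I (ring_on R)"
  shows "ideal (w_closure R I) (ring_on R)"
  unfolding ideal_ring_on_iff[OF R]
proof (intro conjI ballI)
  have I': "0 \<in> I" "\<And>x y. x \<in> I \<Longrightarrow> y \<in> I \<Longrightarrow> x + y \<in> I" "\<And>r x. x \<in> I \<Longrightarrow> r \<in> R \<Longrightarrow> r * x \<in> I"
    using I by (auto simp: ideal_ring_on_iff[OF R])
  show sub: "w_closure R I \<subseteq> R" by (rule w_closure_subset[OF R I])
  show "0 \<in> w_closure R I" using subset_w_closure[OF R I] I' by blast
  fix x assume x: "x \<in> w_closure R I"
  {
    fix y assume y: "y \<in> w_closure R I"
    obtain A where A: "gv_set R A" "\<forall>z\<in>{x, y}. \<forall>a\<in>A. z * a \<in> I"
      using w_closure_common_gv_set[OF R I, of "{x, y}"] x y by auto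
    moreover have "x + y \<in> quot_field R"
      using x y sub subdomain_closed(3)[OF R] subset_quot_field[OF R] by (meson subsetD)
    moreover have "\<forall>a\<in>A. (x + y) * a \<in> I" using A I'(2) by (simp add: distrib_right)
    ultimately show "x + y \<in> w_closure R I" unfolding w_closure_iff[OF R I] by blast
  next
    fix r assume r: "r \<in> R"
    obtain A where A: "gv_set R A" "\<forall>a\<in>A. x * a \<in> I" using x by (auto simp: w_closure_iff[OF R I])
    moreover have "r * x \<in> quot_field R"
      using x r sub subdomain_closed(4)[OF R] subset_quot_field[OF R] by (meson subsetD)
    moreover have "\<forall>a\<in>A. r * x * a \<in> I" using A I'(3) r by (simp add: mult.assoc)
    ultimately show "r * x \<in> w_closure R I" unfolding w_closure_iff[OF R I] by blast
  }
qed

lemma w_ideal_w_closure: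
  assumes R: "subdomain R (ring_of_type_algebra :: 'f::field ring)"
    and I: "ideal I (ring_on R)" and "I \<noteq> {0}"
  shows "w_ideal R (w_closure R I)"
  unfolding w_ideal_def
proof (intro conjI)
  note W = ideal_w_closure[OF R I]
  show "ideal (w_closure R I) (ring_on R)" by (rule W)
  have "0 \<in> I" using I by (auto simp: ideal_ring_on_iff[OF R])
  then show "w_closure R I \<noteq> {0}" using subset_w_closure[OF R I] \<open>I \<noteq> {0}\<close> by blast
  show "w_closure R (w_closure R I) = w_closure R I"
  proof
    show "w_closure R (w_closure R I) \<subseteq> w_closure R I"
    proof
      fix x assume "x \<in> w_closure R (w_closure R I)"
      then obtain A where x: "x \<in> quot_field R" and A: "gv_set R A" "\<forall>a\<in>A. x * a \<in> w_closure R I"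
        by (auto simp: w_closure_iff[OF R W])
      obtain B where B: "gv_set R B" "\<forall>z\<in>(*) x ` A. \<forall>b\<in>B. z * b \<in> I"
      proof -
        have "finite ((*) x ` A)" "(*) x ` A \<subseteq> w_closure R I" using A by (auto simp: gv_set_def)
        then show thesis using w_closure_common_gv_set[OF R I] that by blast
      qed
      then have "\<forall>c\<in>{a * b |a b. a \<in> A \<and> b \<in> B}. x * c \<in> I" by (auto simp: mult.assoc)
      then show "x \<in> w_closure R I"
        using x gv_set_mult[OF R A(1) B(1)] unfolding w_closure_iff[OF R I] by blast
    qed
  qed (rule subset_w_closure[OF R W])
qed

text \<open>Nonzero ideals that consist of the common denominators in \<open>R\<close> of a set \<open>Y\<close> of fractions are w-ideals.\<close>

lemma w_ideal_divisorial:
  assumes R: "subdomain R (ring_of_type_algebra :: 'f::field ring)"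
    and Y: "Y \<subseteq> quot_field R"
    and nz: "{f \<in> R. \<forall>y\<in>Y. y * f \<in> R} \<noteq> {0}"
  shows "w_ideal R {f \<in> R. \<forall>y\<in>Y. y * f \<in> R}" (is "w_ideal R ?I")
  unfolding w_ideal_def
proof (intro conjI)
  show I: "ideal ?I (ring_on R)"
    using subdomain_closed[OF R] unfolding ideal_ring_on_iff[OF R]
    by (auto simp: distrib_left mult.left_commute)
  show "w_closure R ?I = ?I"
  proof
    show "w_closure R ?I \<subseteq> ?I"
    proof
      fix x assume "x \<in> w_closure R ?I"
      then obtain A where x: "x \<in> quot_field R" and A: "gv_set R A" "\<forall>a\<in>A. x * a \<in> ?I"
        by (auto simp: w_closure_iff[OF R I])
      have "y * x \<in> R" if "y \<in> Y" for y
      proof (rule gv_set_mem[OF A(1)])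
        show "y * x \<in> quot_field R" using Y that x by (intro quot_field_mult[OF R]) auto
        show "y * x * a \<in> R" if "a \<in> A" for a using A(2) that \<open>y \<in> Y\<close> by (simp add: mult.assoc)
      qed
      moreover have "x \<in> R" using A(2) by (intro gv_set_mem[OF A(1) x]) simp
      ultimately show "x \<in> ?I" by simp
    qed
  qed (rule subset_w_closure[OF R I])
qed (rule nz)

section \<open>Evaluation of rational functions\<close>

text \<open>The constant rational function with value \<open>c\<close>.\<close>

definition const_fract :: "'k::field \<Rightarrow> 'k poly fract"
  where "const_fract c = Fract [:c:] 1"

lemma const_fract_mult: "const_fract (c * d) = const_fract c * const_fract d"
  by (simp add: const_fract_def mult.commute)

lemma const_fract_divide: "d \<noteq> 0 \<Longrightarrow> const_fract (c / d) = const_fract c / const_fract d"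
  by (simp add: const_fract_def eq_fract)

lemma const_fract_eq_0_iff [simp]: "const_fract c = 0 \<longleftrightarrow> c = 0"
  by (simp add: const_fract_def Zero_fract_def eq_fract)

lemma rat_const_fract [simp]: "rat_defined_at (const_fract c) e" "rat_val (const_fract c) e = c"
  by (auto simp: const_fract_def rat_defined_at_def rat_val_Fract intro: exI[of _ "1 :: 'a poly"])
    (metis one_neq_zero poly_1)

lemma rat_mult:
  assumes "rat_defined_at f e" "rat_defined_at g e"
  shows "rat_defined_at (f * g) e" "rat_val (f * g) e = rat_val f e * rat_val g e"
proof -
  obtain p q p' q' where *: "f = Fract p q" "poly q e \<noteq> 0" "g = Fract p' q'" "poly q' e \<noteq> 0"
    using assms by (auto simp: rat_defined_at_def)
  then have fg: "f * g = Fract (p * p') (q * q')" "poly (q * q') e \<noteq> 0" by auto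
  then show "rat_defined_at (f * g) e" unfolding rat_defined_at_def by blast
  show "rat_val (f * g) e = rat_val f e * rat_val g e"
    unfolding fg(1) rat_val_Fract[OF fg(2)] by (simp add: * rat_val_Fract)
qed

lemma rat_add:
  assumes "rat_defined_at f e" "rat_defined_at g e"
  shows "rat_defined_at (f + g) e" "rat_val (f + g) e = rat_val f e + rat_val g e"
proof -
  obtain p q p' q' where *: "f = Fract p q" "poly q e \<noteq> 0" "g = Fract p' q'" "poly q' e \<noteq> 0"
    using assms by (auto simp: rat_defined_at_def)
  moreover from this have "q \<noteq> 0" "q' \<noteq> 0" by auto
  ultimately have fg: "f + g = Fract (p * q' + p' * q) (q * q')" "poly (q * q') e \<noteq> 0" by auto
  then show "rat_defined_at (f + g) e" unfolding rat_defined_at_def by blast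
  show "rat_val (f + g) e = rat_val f e + rat_val g e"
    unfolding fg(1) rat_val_Fract[OF fg(2)] using * by (simp add: rat_val_Fract add_frac_eq)
qed

lemma const_fract_mem_Int_R: "E \<noteq> {} \<Longrightarrow> const_fract c \<in> Int_R E D \<longleftrightarrow> c \<in> D"
  by (auto simp: Int_R_def)

lemma ideal_Int_R:
  assumes D: "subdomain D (ring_of_type_algebra :: 'k::field ring)"
    and R: "subdomain (Int_R E D) (ring_of_type_algebra :: 'k poly fract ring)"
    and I: "ideal I (ring_on D)"
  shows "ideal (Int_R E I) (ring_on (Int_R E D))"
  unfolding ideal_ring_on_iff[OF R]
proof (intro conjI)
  note I' = I[unfolded ideal_ring_on_iff[OF D]]
  show "Int_R E I \<subseteq> Int_R E D" using I' by (auto simp: Int_R_def)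
  have "const_fract 0 \<in> Int_R E I" using I' by (simp add: Int_R_def)
  then show "0 \<in> Int_R E I" by (metis const_fract_eq_0_iff)
qed (use I[unfolded ideal_ring_on_iff[OF D]] in \<open>auto simp: Int_R_def rat_add rat_mult\<close>)

lemma const_fract_mem_quot_field:
  assumes "quot_field D = UNIV" "E \<noteq> {}"
  shows "const_fract c \<in> quot_field (Int_R E D)"
proof -
  have "c \<in> quot_field D" using assms by simp
  then obtain a b where "c = a / b" "a \<in> D" "b \<in> D" "b \<noteq> 0" unfolding quot_field_def by blast
  then have "const_fract c = const_fract a / const_fract b" "const_fract a \<in> Int_R E D"
    "const_fract b \<in> Int_R E D" "const_fract b \<noteq> 0"
    using const_fract_mem_Int_R[OF assms(2)] by (simp_all add: const_fract_divide)
  then show ?thesis unfolding quot_field_def by blast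
qed

section \<open>Descent of the strong Mori property\<close>

text \<open>
  A Mori-type finiteness property of \<open>D\<close>. If it failed for \<open>A\<close>, one could keep adjoining elements of
  \<open>A\<close> to a finite set so that its inverse drops at each step; the divisorial ideals of \<open>Int_R E D\<close>
  given by these inverses, regarded as sets of constants, would form a strictly ascending chain
  of w-ideals.
\<close>

lemma frac_inverse_finite_subset:
  fixes D E :: "'k::field set"
  assumes D: "subdomain D ring_of_type_algebra" and K: "quot_field D = UNIV" and E: "E \<noteq> {}"
    and SM: "strong_mori_domain (Int_R E D)"
    and A: "A \<subseteq> D" "a \<in> A" "a \<noteq> 0"
  shows "\<exists>F\<subseteq>A. finite F \<and> frac_inverse D F = frac_inverse D A"
proof (rule ccontr)
  define R where "R = Int_R E D"
  have R: "subdomain R ring_of_type_algebra" using SM by (simp add: strong_mori_domain_def R_def)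
  assume neg: "\<not> ?thesis"
  have "\<exists>b\<in>A. \<exists>y\<in>frac_inverse D F. y * b \<notin> D" if "F \<subseteq> A" "finite F" for F
  proof -
    have "frac_inverse D A \<subseteq> frac_inverse D F" using that by (auto simp: frac_inverse_def)
    moreover have "frac_inverse D F \<noteq> frac_inverse D A" using neg that by blast
    ultimately show ?thesis by (auto simp: frac_inverse_def)
  qed
  then obtain g where g: "\<And>F. F \<subseteq> A \<Longrightarrow> finite F \<Longrightarrow> g F \<in> A \<and> (\<exists>y\<in>frac_inverse D F. y * g F \<notin> D)"
    by metis
  define F where "F n = ((\<lambda>F. insert (g F) F) ^^ n) {a}" for n
  have F0: "F 0 = {a}" and FS: "F (Suc n) = insert (g (F n)) (F n)" for n by (simp_all add: F_def)
  have F: "F n \<subseteq> A \<and> finite (F n) \<and> a \<in> F n" for n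
    by (induction n) (use A g in \<open>auto simp: F0 FS\<close>)
  define \<I> where "\<I> n = {f \<in> R. \<forall>y\<in>const_fract ` frac_inverse D (F n). y * f \<in> R}" for n
  have const: "const_fract b \<in> \<I> n \<longleftrightarrow> b \<in> D \<and> (\<forall>y\<in>frac_inverse D (F n). y * b \<in> D)" for b n
    using E by (simp add: \<I>_def R_def const_fract_mem_Int_R flip: const_fract_mult)
  have "w_ideal R (\<I> n)" for n
    unfolding \<I>_def
  proof (rule w_ideal_divisorial[OF R])
    show "const_fract ` frac_inverse D (F n) \<subseteq> quot_field R"
      using const_fract_mem_quot_field[OF K E] by (auto simp: R_def)
    have "const_fract a \<in> \<I> n" unfolding const using A F[of n] by (auto simp: frac_inverse_def)
    moreover have "const_fract a \<noteq> 0" using A by simp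
    ultimately show "{f \<in> R. \<forall>y\<in>const_fract ` frac_inverse D (F n). y * f \<in> R} \<noteq> {0}"
      unfolding \<I>_def by blast
  qed
  moreover have "\<I> n \<subseteq> \<I> (Suc n)" for n by (auto simp: \<I>_def FS frac_inverse_def)
  ultimately have "\<exists>N. \<forall>n\<ge>N. \<I> n = \<I> N"
    by (rule strong_mori_domain_stabilizes[OF SM[folded R_def]])
  then obtain N where N: "\<forall>n\<ge>N. \<I> n = \<I> N" ..
  have "\<I> (Suc N) = \<I> N" by (rule N[rule_format]) simp
  moreover have "const_fract (g (F N)) \<in> \<I> (Suc N)"
    unfolding const using g[of "F N"] F[of N] A by (auto simp: FS frac_inverse_def)
  ultimately have "\<forall>y\<in>frac_inverse D (F N). y * g (F N) \<in> D" using const by simp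
  then show False using g[of "F N"] F[of N] by blast
qed

text \<open>
  If \<open>B\<close> is a Glaz--Vasconcelos set of \<open>Int_R E D\<close> multiplying the constant \<open>x\<close> into \<open>Int_R E I\<close>, then
  all values of members of \<open>B\<close> multiply \<open>x\<close> into \<open>I\<close>. These values generate an ideal of \<open>D\<close> with inverse
  \<open>D\<close>, and by the finiteness property finitely many of them suffice for that.
\<close>

lemma const_fract_mem_w_closure_Int_R:
  fixes D E :: "'k::field set"
  assumes D: "subdomain D ring_of_type_algebra" and K: "quot_field D = UNIV" and E: "E \<noteq> {}"
    and SM: "strong_mori_domain (Int_R E D)" and I: "w_ideal D I"
  shows "const_fract x \<in> w_closure (Int_R E D) (Int_R E I) \<longleftrightarrow> x \<in> I"
proof
  define R where "R = Int_R E D"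
  have R: "subdomain R ring_of_type_algebra" using SM by (simp add: strong_mori_domain_def R_def)
  have idl: "ideal I (ring_on D)" using I by (simp add: w_ideal_def)
  note I' = idl[unfolded ideal_ring_on_iff[OF D]]
  have idl': "ideal (Int_R E I) (ring_on R)"
    using ideal_Int_R[OF D _ idl] R by (simp add: R_def)
  show "const_fract x \<in> w_closure (Int_R E D) (Int_R E I)" if "x \<in> I"
    using subset_w_closure[OF R idl'] const_fract_mem_Int_R[OF E] that unfolding R_def by blast
  assume x: "const_fract x \<in> w_closure (Int_R E D) (Int_R E I)"
  show "x \<in> I"
  proof (cases "D = UNIV")
    case True
    obtain i where "i \<in> I" "i \<noteq> 0" using I I' by (auto simp: w_ideal_def)
    then have "x / i * i \<in> I" using I' True by blast
    then show ?thesis using \<open>i \<noteq> 0\<close> by simp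
  next
    case False
    obtain B where B: "gv_set R B" "\<forall>b\<in>B. const_fract x * b \<in> Int_R E I"
      using x w_closure_iff[OF R idl'] by (auto simp: R_def)
    define A where "A = {rat_val b e |b e. b \<in> B \<and> e \<in> E}"
    have def: "rat_defined_at b e" "rat_val b e \<in> D" if "b \<in> B" "e \<in> E" for b e
      using B(1) that by (auto simp: gv_set_def R_def Int_R_def)
    have "A \<subseteq> D" using def by (auto simp: A_def)
    have xA: "x * a \<in> I" if a: "a \<in> A" for a
    proof -
      obtain b e where be: "a = rat_val b e" "b \<in> B" "e \<in> E" using a by (auto simp: A_def)
      then have "rat_val (const_fract x * b) e \<in> I" using B by (auto simp: Int_R_def)
      then show ?thesis using def be by (simp add: rat_mult)
    qed
    have inv: "frac_inverse D A = D"
    proof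
      show "D \<subseteq> frac_inverse D A"
        using \<open>A \<subseteq> D\<close> K subdomain_closed[OF D] by (auto simp: frac_inverse_def)
      show "frac_inverse D A \<subseteq> D"
      proof
        fix y assume y: "y \<in> frac_inverse D A"
        have "const_fract y \<in> R"
        proof (rule gv_set_mem[OF B(1)])
          show "const_fract y \<in> quot_field R"
            using const_fract_mem_quot_field[OF K E] by (simp add: R_def)
          show "const_fract y * b \<in> R" if "b \<in> B" for b
          proof -
            have "y * rat_val b e \<in> D" if "e \<in> E" for e
              using y \<open>b \<in> B\<close> that unfolding A_def frac_inverse_def by blast
            then show ?thesis using def[OF \<open>b \<in> B\<close>] by (simp add: R_def Int_R_def rat_mult)
          qed
        qed
        then show "y \<in> D" using const_fract_mem_Int_R[OF E] by (simp add: R_def)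
      qed
    qed
    \<comment> \<open>The members of \<open>B\<close> might all vanish on \<open>E\<close>, but then the inverse of \<open>A\<close> would be the whole field.\<close>
    have nz: "\<not> F \<subseteq> {0}" if "frac_inverse D F = D" for F
    proof
      assume "F \<subseteq> {0}"
      then have "frac_inverse D F = UNIV"
        using K subdomain_closed[OF D] by (auto simp: frac_inverse_def)
      then show False using that False by simp
    qed
    obtain a where "a \<in> A" "a \<noteq> 0" using nz[OF inv] by auto
    then obtain F where F: "F \<subseteq> A" "finite F" "frac_inverse D F = D"
      using frac_inverse_finite_subset[OF D K E SM \<open>A \<subseteq> D\<close>] inv by metis
    then have "gv_set D F" using \<open>A \<subseteq> D\<close> nz by (auto simp: gv_set_def)
    then have "x \<in> w_closure D I"
      unfolding w_closure_iff[OF D idl] using xA F K by auto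
    then show ?thesis using I by (simp add: w_ideal_def)
  qed
qed

theorem proposition3p5:
  fixes D E :: "'k::field set"
  assumes "subdomain D ring_of_type_algebra"
    and "quot_field D = UNIV"
    and "E \<noteq> {}"
    and "strong_mori_domain (Int_R E D)"
  shows "strong_mori_domain D"
  unfolding strong_mori_domain_def
proof (intro conjI allI impI)
  show D: "subdomain D ring_of_type_algebra" by fact
  have R: "subdomain (Int_R E D) ring_of_type_algebra"
    using assms(4) by (simp add: strong_mori_domain_def)
  fix I :: "nat \<Rightarrow> 'k set"
  assume I: "(\<forall>n. w_ideal D (I n)) \<and> (\<forall>n. I n \<subseteq> I (Suc n))"
  define W where "W n = w_closure (Int_R E D) (Int_R E (I n))" for n
  have const: "const_fract x \<in> W n \<longleftrightarrow> x \<in> I n" for x n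
    unfolding W_def using const_fract_mem_w_closure_Int_R[OF assms] I by blast
  have "w_ideal (Int_R E D) (W n)" for n
    unfolding W_def
  proof (rule w_ideal_w_closure[OF R])
    have idl: "ideal (I n) (ring_on D)" "I n \<noteq> {0}" using I by (auto simp: w_ideal_def)
    then show "ideal (Int_R E (I n)) (ring_on (Int_R E D))" by (intro ideal_Int_R[OF D R])
    obtain i where "i \<in> I n" "i \<noteq> 0" using idl by (auto simp: ideal_ring_on_iff[OF D])
    then have "const_fract i \<in> Int_R E (I n)" "const_fract i \<noteq> 0"
      using const_fract_mem_Int_R[OF assms(3)] by auto
    then show "Int_R E (I n) \<noteq> {0}" by blast
  qed
  moreover have "W n \<subseteq> W (Suc n)" for n
  proof -
    have "Int_R E (I n) \<subseteq> Int_R E (I (Suc n))" using I by (auto simp: Int_R_def)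
    then show ?thesis unfolding W_def w_closure_def by blast
  qed
  ultimately have "\<exists>N. \<forall>n\<ge>N. W n = W N"
    by (rule strong_mori_domain_stabilizes[OF assms(4)])
  then obtain N where N: "\<forall>n\<ge>N. W n = W N" ..
  have "I n = {x. const_fract x \<in> W n}" for n using const by simp
  then have "\<forall>n\<ge>N. I n = I N" using N by metis
  then show "\<exists>N. \<forall>n\<ge>N. I n = I N" ..
qed

end
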